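(* Let $\mathrm{LB}$ be the objective-function value of a feasible solution of CMESP, and let $(\hat\Theta_1,\dots,\hat\Theta_m,\hat\upsilon,\hat\nu,\hat\pi,\hat\tau)$ be a feasible solution of Dmix with objective-function value $\hat\zeta$. Then every optimal solution $x^*$ of CMESP satisfies $$x_j^*=0\ \text{ for all } j\in N \text{ such that } \hat\zeta-\mathrm{LB}<\hat\upsilon_j,$$ $$x_j^*=1\ \text{ for all } j\in N \text{ such that } \hat\zeta-\mathrm{LB}<\hat\nu_j.$$
   Context: Let $n>1$, $0<s<n$ be integers, $N:=\{1,\dots,n\}$, let $C$ be a real symmetric positive semidefinite $n\times n$ matrix, and let $A\in\mathbb{R}^{p\times n}$, $b\in\mathbb{R}^p$. $\mathbf{e}$ is the all-ones vector; vector inequalities are componentwise; $A_{\cdot j}$ is the $j$-th column of $A$; $X\bullet Y:=\operatorname{tr}(X^\top Y)$. $\mathbb{S}^k$, $\mathbb{S}^k_+$, $\mathbb{S}^k_{++}$ denote the symmetric, symmetric positive semidefinite, and symmetric positive definite real matrices of order $k$. $\operatorname{ldet}$ is the natural logarithm of the determinant (equal to $-\infty$ for a singular positive semidefinite matrix). For $x\in\{0,1\}^n$, $S(x)$ is its support, and $C[S,S]$ is the principal submatrix of $C$ indexed by $S$. CMESP is the problem $$\max\{\operatorname{ldet}C[S(x),S(x)] : \mathbf{e}^\top x=s,\ Ax\le b,\ x\in\{0,1\}^n\}.$$ Let $m\ge1$ and consider $m$ convex relaxations of CMESP, indexed by $i=1,\dots,m$: $$v_i:=\max\{f_i(L_i(x))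 : \mathbf{e}^\top x=s,\ Ax\le b,\ 0\le x\le\mathbf{e}\},$$ where $k_i\le n$, $L_i(x)=L_{i0}+L_{i1}x_1+\cdots+L_{in}x_n$ is affine with $L_{ij}\in\mathbb{S}^{k_i}$ for $j=0,\dots,n$ and with $L_i(x)\in\mathbb{S}^{k_i}_+$ for every $x\in[0,1]^n$, and $f_i:\mathbb{S}^{k_i}_+\to\mathbb{R}\cup\{-\infty\}$ is concave. Being a relaxation of CMESP means $f_i(L_i(x))\ge\operatorname{ldet}C[S(x),S(x)]$ for every feasible solution $x$ of CMESP. Let $\alpha\in\mathbb{R}^m_+$ with $\mathbf{e}^\top\alpha=1$. The mixing bound is $$v(\alpha):=\max\Big\{\sum_{i=1}^m\alpha_if_i(L_i(x)) : \mathbf{e}^\top x=s,\ Ax\le b,\ 0\le x\le\mathbf{e}\Big\}.$$ Assume that for each $i=1,\dots,m$ and each $\Theta_i\in\mathbb{S}^{k_i}_{++}$, the supremum $\sup\{f_i(W_i)-\Theta_i\bullet W_i : W_i\succeq0\}$ is attained at some $\hat W_i$ (given in closed form) with $f_i(\hat W_i)$ finite and $\Theta_i\bullet\hat W_i=\rho_i$, where $\rho_i\in\mathbb{R}$ is a constant not depending on $\Theta_i$; and define $\Omega_i:\mathbb{S}^{k_i}_{++}\to\mathbb{R}$ by $\Omega_i(\Theta_i):=f_i(\hat W_i)$. Assume further that this supremum is $+\infty$ whenever $\Theta_i\in\mathbb{S}^{k_i}$ is not positive definite. Dmix is the problem (equivalent to the Lagrangian dual of the mixing problem): minimize $$\sum_{i=1}^m\alpha_i\big(\Omega_i(\Theta_i)-\rho_i+\Theta_i\bullet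 L_{i0}\big)+\nu^\top\mathbf{e}+\pi^\top b+\tau s$$ over $\Theta_i\in\mathbb{S}^{k_i}$ ($i=1,\dots,m$), $\upsilon,\nu\in\mathbb{R}^n$, $\pi\in\mathbb{R}^p$, $\tau\in\mathbb{R}$, subject to $$\sum_{i=1}^m\alpha_i(\Theta_i\bullet L_{ij})+\upsilon_j-\nu_j-\pi^\top A_{\cdot j}-\tau=0\quad\text{for } j\in N,$$ $$\Theta_1\succ0,\dots,\Theta_m\succ0,\ \upsilon\ge0,\ \nu\ge0,\ \pi\ge0 .$$ *)

theory Defs
  imports
    "HOL-Library.Extended_Real"
    "Jordan_Normal_Form.Determinant"
    "Jordan_Normal_Form.DL_Submatrix"
begin

text \<open>
  Vectors and matrices are those of \<^theory>\<open>Jordan_Normal_Form.Matrix\<close>, with dimensions given by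
  natural numbers, since the orders of the matrices in a family of relaxations vary with its index.
  Indices start at 0: the index set of the variables is \<open>{0..<n}\<close>, and the relaxations are indexed
  by \<open>{0..<m}\<close>.
\<close>

subsection \<open>Symmetric matrices\<close>

definition symm_mats :: "nat \<Rightarrow> real mat set" where
  "symm_mats k = {X \<in> carrier_mat k k. X\<^sup>T = X}"

definition psd_mats :: "nat \<Rightarrow> real mat set" where
  "psd_mats k = {X \<in> symm_mats k. \<forall>v \<in> carrier_vec k. 0 \<le> v \<bullet> (X *\<^sub>v v)}"

definition pd_mats :: "nat \<Rightarrow> real mat set" where
  "pd_mats k = {X \<in> symm_mats k. \<forall>v \<in> carrier_vec k. v \<noteq> 0\<^sub>v k \<longrightarrow> 0 < v \<bullet> (X *\<^sub>v v)}"

definition mat_trace :: "real mat \<Rightarrow> real" where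
  "mat_trace X = (\<Sum>i<dim_row X. X $$ (i, i))"

definition mat_inner :: "real mat \<Rightarrow> real mat \<Rightarrow> real" where
  "mat_inner X Y = mat_trace (X\<^sup>T * Y)"

text \<open>Only meant for positive semidefinite arguments, whose determinant is nonnegative.\<close>

definition ldet :: "real mat \<Rightarrow> ereal" where
  "ldet X = (if 0 < det X then ereal (ln (det X)) else - \<infinity>)"

text \<open>Concavity for functions with values in the reals extended by \<open>- \<infinity>\<close>; the endpoints of the
  segment are left out because there the inequality is trivial.\<close>

definition concave_ext_on :: "real mat set \<Rightarrow> (real mat \<Rightarrow> ereal) \<Rightarrow> bool" where
  "concave_ext_on K f \<longleftrightarrow>
     (\<forall>X\<in>K. \<forall>Y\<in>K. \<forall>t::real. 0 < t \<and> t < 1 \<longrightarrow>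
        ereal t * f X + ereal (1 - t) * f Y \<le> f (t \<cdot>\<^sub>m X + (1 - t) \<cdot>\<^sub>m Y))"

subsection \<open>The constrained maximum-entropy sampling problem\<close>

definition ones_vec :: "nat \<Rightarrow> real vec" where
  "ones_vec n = vec n (\<lambda>_. 1)"

definition supp_vec :: "real vec \<Rightarrow> nat set" where
  "supp_vec x = {j. j < dim_vec x \<and> x $ j \<noteq> 0}"

definition cmesp_feasible :: "nat \<Rightarrow> nat \<Rightarrow> real mat \<Rightarrow> real vec \<Rightarrow> real vec \<Rightarrow> bool" where
  "cmesp_feasible n s A b x \<longleftrightarrow>
     x \<in> carrier_vec n \<and> (\<forall>j<n. x $ j \<in> {0, 1}) \<and> ones_vec n \<bullet> x = real s \<and> A *\<^sub>v x \<le> b"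

definition cmesp_obj :: "real mat \<Rightarrow> real vec \<Rightarrow> ereal" where
  "cmesp_obj C x = ldet (submatrix C (supp_vec x) (supp_vec x))"

definition cmesp_optimal ::
  "nat \<Rightarrow> nat \<Rightarrow> real mat \<Rightarrow> real mat \<Rightarrow> real vec \<Rightarrow> real vec \<Rightarrow> bool" where
  "cmesp_optimal n s C A b x \<longleftrightarrow>
     cmesp_feasible n s A b x \<and> (\<forall>y. cmesp_feasible n s A b y \<longrightarrow> cmesp_obj C y \<le> cmesp_obj C x)"

subsection \<open>Mixing\<close>

text \<open>The affine map \<open>x \<mapsto> L 0 + (\<Sum>j<n. x $ j * L (Suc j))\<close> into the matrices of order \<open>k\<close>. The
  coefficient of the variable \<open>x $ j\<close> is \<open>L (Suc j)\<close>, as \<open>L 0\<close> is the constant term.\<close>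

definition affine_mat :: "nat \<Rightarrow> nat \<Rightarrow> (nat \<Rightarrow> real mat) \<Rightarrow> real vec \<Rightarrow> real mat" where
  "affine_mat n k L x = mat k k (\<lambda>(r, c). L 0 $$ (r, c) + (\<Sum>j<n. x $ j * L (Suc j) $$ (r, c)))"

text \<open>\<open>What i \<Theta>\<close> is the maximizer of \<open>f i W - \<Theta> \<bullet> W\<close> over the positive semidefinite
  \<open>W\<close>; the value of \<open>f i\<close> at it is finite for positive definite \<open>\<Theta>\<close>.\<close>

definition mix_Omega ::
  "(nat \<Rightarrow> real mat \<Rightarrow> ereal) \<Rightarrow> (nat \<Rightarrow> real mat \<Rightarrow> real mat) \<Rightarrow> nat \<Rightarrow> real mat \<Rightarrow> real" where
  "mix_Omega f What i \<Theta> = real_of_ereal (f i (What i \<Theta>))"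

definition dmix_feasible ::
  "nat \<Rightarrow> nat \<Rightarrow> nat \<Rightarrow> real mat \<Rightarrow> (nat \<Rightarrow> nat) \<Rightarrow> (nat \<Rightarrow> nat \<Rightarrow> real mat) \<Rightarrow> real vec \<Rightarrow>
   (nat \<Rightarrow> real mat) \<Rightarrow> real vec \<Rightarrow> real vec \<Rightarrow> real vec \<Rightarrow> real \<Rightarrow> bool" where
  "dmix_feasible n p m A k L \<alpha> \<Theta> \<upsilon> \<nu> \<pi> \<tau> \<longleftrightarrow>
     \<upsilon> \<in> carrier_vec n \<and> \<nu> \<in> carrier_vec n \<and> \<pi> \<in> carrier_vec p \<and>
     (\<forall>j<n. (\<Sum>i<m. \<alpha> $ i * mat_inner (\<Theta> i) (L i (Suc j))) + \<upsilon> $ j - \<nu> $ j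
              - \<pi> \<bullet> col A j - \<tau> = 0) \<and>
     (\<forall>i<m. \<Theta> i \<in> pd_mats (k i)) \<and> 0\<^sub>v n \<le> \<upsilon> \<and> 0\<^sub>v n \<le> \<nu> \<and> 0\<^sub>v p \<le> \<pi>"

definition dmix_obj ::
  "nat \<Rightarrow> nat \<Rightarrow> nat \<Rightarrow> real vec \<Rightarrow> (nat \<Rightarrow> nat \<Rightarrow> real mat) \<Rightarrow> (nat \<Rightarrow> real mat \<Rightarrow> ereal) \<Rightarrow>
   (nat \<Rightarrow> real mat \<Rightarrow> real mat) \<Rightarrow> (nat \<Rightarrow> real) \<Rightarrow> real vec \<Rightarrow>
   (nat \<Rightarrow> real mat) \<Rightarrow> real vec \<Rightarrow> real vec \<Rightarrow> real \<Rightarrow> real" where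
  "dmix_obj n s m b L f What \<rho> \<alpha> \<Theta> \<nu> \<pi> \<tau> =
     (\<Sum>i<m. \<alpha> $ i * (mix_Omega f What i (\<Theta> i) - \<rho> i + mat_inner (\<Theta> i) (L i 0)))
       + \<nu> \<bullet> ones_vec n + \<pi> \<bullet> b + \<tau> * real s"

end

theory Submission
  imports Defs
begin

text \<open>
  Weak duality, keeping track of the slack. Let \<open>x\<close> be feasible for CMESP with objective value \<open>z\<close>.
  The Fenchel inequality at \<open>\<Theta> i\<close> bounds each \<open>f i (L i x)\<close>, hence \<open>z\<close>, by an affine function of
  \<open>x\<close>; averaging with the weights \<open>\<alpha>\<close> and eliminating the coefficients of \<open>x\<close> by the dual constraints
  gives \<open>z + \<upsilon> \<bullet> x + \<nu> \<bullet> (e - x) \<le> \<zeta>\<close>. All slack terms are nonnegative, so at an optimal \<open>x\<close>, where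
  \<open>LB \<le> z\<close>, each of them is at most \<open>\<zeta> - LB\<close>.
\<close>

lemma ldet_not_PInf: "ldet X \<noteq> \<infinity>"
  by (simp add: ldet_def)

lemma mat_inner_eq_sum:
  assumes "X \<in> carrier_mat k k" and "Y \<in> carrier_mat k k"
  shows "mat_inner X Y = (\<Sum>c<k. \<Sum>r<k. X $$ (r, c) * Y $$ (r, c))"
  using assms
  by (auto simp: mat_inner_def mat_trace_def scalar_prod_def atLeast0LessThan intro!: sum.cong)

text \<open>The trace product is linear in its second argument and \<open>affine_mat\<close> is
  defined entrywise. Expanding both into entries and moving the sum over \<open>j\<close> outermost,
  one index at a time, isolates the coefficient of each \<open>x $ j\<close>.\<close>

lemma mat_inner_affine_mat:
  assumes "T \<in> carrier_mat k k" and L: "\<And>j. j \<le> n \<Longrightarrow> L j \<in> carrier_mat k k"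
  shows "mat_inner T (affine_mat n k L x)
    = mat_inner T (L 0) + (\<Sum>j<n. x $ j * mat_inner T (L (Suc j)))"
proof -
  have "mat_inner T (affine_mat n k L x)
    = (\<Sum>c<k. \<Sum>r<k. T $$ (r, c) * (L 0 $$ (r, c) + (\<Sum>j<n. x $ j * L (Suc j) $$ (r, c))))"
    by (subst mat_inner_eq_sum[OF assms(1)]) (auto simp: affine_mat_def)
  also have "\<dots> = mat_inner T (L 0)
      + (\<Sum>c<k. \<Sum>r<k. \<Sum>j<n. x $ j * (T $$ (r, c) * L (Suc j) $$ (r, c)))"
    using assms by (simp add: mat_inner_eq_sum distrib_left sum.distrib sum_distrib_left ac_simps)
  also have "(\<Sum>c<k. \<Sum>r<k. \<Sum>j<n. x $ j * (T $$ (r, c) * L (Suc j) $$ (r, c)))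
      = (\<Sum>c<k. \<Sum>j<n. \<Sum>r<k. x $ j * (T $$ (r, c) * L (Suc j) $$ (r, c)))"
    by (intro sum.cong refl sum.swap)
  also have "\<dots> = (\<Sum>j<n. \<Sum>c<k. \<Sum>r<k. x $ j * (T $$ (r, c) * L (Suc j) $$ (r, c)))"
    by (rule sum.swap)
  also have "\<dots> = (\<Sum>j<n. x $ j * mat_inner T (L (Suc j)))"
    using assms by (intro sum.cong refl) (simp add: mat_inner_eq_sum sum_distrib_left)
  finally show ?thesis .
qed

text \<open>Expansion by columns, chosen so that for \<open>y = \<pi>\<close> the coefficient of
  \<open>x $ j\<close> is exactly the term \<open>\<pi> \<bullet> col A j\<close> of the dual
  constraints.\<close>

lemma scalar_prod_mult_mat_vec:
  fixes A :: "real mat"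
  assumes "A \<in> carrier_mat p n" and "x \<in> carrier_vec n" and "y \<in> carrier_vec p"
  shows "y \<bullet> (A *\<^sub>v x) = (\<Sum>j<n. x $ j * (y \<bullet> col A j))"
proof -
  have "y \<bullet> (A *\<^sub>v x) = (\<Sum>i<p. \<Sum>j<n. x $ j * (y $ i * A $$ (i, j)))"
    using assms
    by (auto simp: scalar_prod_def atLeast0LessThan sum_distrib_left ac_simps intro!: sum.cong)
  also have "\<dots> = (\<Sum>j<n. \<Sum>i<p. x $ j * (y $ i * A $$ (i, j)))"
    by (rule sum.swap)
  also have "\<dots> = (\<Sum>j<n. x $ j * (y \<bullet> col A j))"
    using assms by (auto simp: scalar_prod_def atLeast0LessThan sum_distrib_left intro!: sum.cong)
  finally show ?thesis .
qed

lemma scalar_prod_mono: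
  fixes u v y :: "real vec"
  assumes "0\<^sub>v p \<le> y" and "u \<le> v" and "v \<in> carrier_vec p"
  shows "y \<bullet> u \<le> y \<bullet> v"
  using assms by (auto simp: scalar_prod_def less_eq_vec_def intro!: sum_mono mult_left_mono)

text \<open>Passage from extended reals to reals: the real lower bound \<open>z\<close> excludes
  \<open>F = -\<infinity>\<close>, and finiteness of \<open>G\<close> excludes
  \<open>F = \<infinity>\<close>, so only real arithmetic remains.\<close>

lemma conjugate_bound:
  fixes F G :: ereal and z t r :: real
  assumes "ereal z \<le> F" and "F - ereal t \<le> G - ereal r" and "\<bar>G\<bar> \<noteq> \<infinity>"
  shows "z \<le> real_of_ereal G - r + t"
  using assms by (cases F; cases G) auto

text \<open>The sum over \<open>j\<close> is the slack that ordinary weak duality discards. With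
  \<open>z\<close> real and the relaxations entering only through \<open>bound\<close>, the whole
  argument is a computation in the reals; infinite values are left to the caller.\<close>

lemma dmix_slack:
  assumes feas: "dmix_feasible n p m A k L \<alpha> \<Theta> \<upsilon> \<nu> \<pi> \<tau>"
    and A: "A \<in> carrier_mat p n" and b: "b \<in> carrier_vec p"
    and \<alpha>: "\<alpha> \<in> carrier_vec m" "0\<^sub>v m \<le> \<alpha>" "ones_vec m \<bullet> \<alpha> = 1"
    and x: "x \<in> carrier_vec n" "ones_vec n \<bullet> x = real s" "A *\<^sub>v x \<le> b"
    and L: "\<And>i j. i < m \<Longrightarrow> j \<le> n \<Longrightarrow> L i j \<in> carrier_mat (k i) (k i)"
    and bound: "\<And>i. i < m \<Longrightarrow>
      z \<le> mix_Omega f What i (\<Theta> i) - \<rho> i + mat_inner (\<Theta> i) (affine_mat n (k i) (L i) x)"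
  shows "z + (\<Sum>j<n. \<upsilon> $ j * x $ j + \<nu> $ j * (1 - x $ j))
    \<le> dmix_obj n s m b L f What \<rho> \<alpha> \<Theta> \<nu> \<pi> \<tau>"
proof -
  let ?M = "\<lambda>i j. mat_inner (\<Theta> i) (L i j)"
  let ?K = "\<lambda>i. mix_Omega f What i (\<Theta> i) - \<rho> i + ?M i 0"
  have \<nu>: "\<nu> \<in> carrier_vec n" and \<pi>: "\<pi> \<in> carrier_vec p" "0\<^sub>v p \<le> \<pi>"
    using feas unfolding dmix_feasible_def by auto
  have eq: "(\<Sum>i<m. \<alpha> $ i * ?M i (Suc j)) = \<nu> $ j - \<upsilon> $ j + \<pi> \<bullet> col A j + \<tau>" if "j < n" for j
    using feas that unfolding dmix_feasible_def by (auto simp: algebra_simps)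
  have \<Theta>: "\<Theta> i \<in> carrier_mat (k i) (k i)" if "i < m" for i
    using feas that unfolding dmix_feasible_def pd_mats_def symm_mats_def by auto
  have sum_\<alpha>: "(\<Sum>i<m. \<alpha> $ i) = 1" and sum_x: "(\<Sum>j<n. x $ j) = real s"
    using \<alpha> x by (auto simp: scalar_prod_def ones_vec_def atLeast0LessThan)
  \<comment> \<open>The weights sum to 1, so \<open>z\<close> is its own average and
    \<open>bound\<close> can be applied termwise.\<close>
  have "z = (\<Sum>i<m. \<alpha> $ i * z)"
    using sum_\<alpha> by (simp flip: sum_distrib_right)
  also have "\<dots> \<le> (\<Sum>i<m. \<alpha> $ i * (?K i + (\<Sum>j<n. x $ j * ?M i (Suc j))))"
  proof (intro sum_mono mult_left_mono)
    fix i assume "i \<in> {..<m}"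
    then have i: "i < m" by simp
    show "z \<le> ?K i + (\<Sum>j<n. x $ j * ?M i (Suc j))"
      using bound[OF i] mat_inner_affine_mat[OF \<Theta>[OF i], of n "L i" x] L[OF i] by simp
    show "0 \<le> \<alpha> $ i"
      using \<alpha> i by (auto simp: less_eq_vec_def)
  qed
  also have "\<dots> = (\<Sum>i<m. \<alpha> $ i * ?K i) + (\<Sum>i<m. \<Sum>j<n. x $ j * (\<alpha> $ i * ?M i (Suc j)))"
    by (simp add: distrib_left sum.distrib sum_distrib_left ac_simps)
  \<comment> \<open>Collecting by \<open>j\<close> makes the coefficient of \<open>x $ j\<close> the
    left-hand side of \<open>eq\<close>.\<close>
  also have "(\<Sum>i<m. \<Sum>j<n. x $ j * (\<alpha> $ i * ?M i (Suc j)))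
      = (\<Sum>j<n. \<Sum>i<m. x $ j * (\<alpha> $ i * ?M i (Suc j)))"
    by (rule sum.swap)
  also have "\<dots> = (\<Sum>j<n. x $ j * (\<nu> $ j - \<upsilon> $ j + \<pi> \<bullet> col A j + \<tau>))"
    by (intro sum.cong refl) (simp add: eq flip: sum_distrib_left)
  \<comment> \<open>Since \<open>x $ j * (\<nu> $ j - \<upsilon> $ j)\<close> is
    \<open>\<nu> $ j\<close> minus the slack term of index \<open>j\<close>, the slack splits
    off.\<close>
  also have "\<dots> = (\<Sum>j<n. \<nu> $ j) - (\<Sum>j<n. \<upsilon> $ j * x $ j + \<nu> $ j * (1 - x $ j))
      + (\<Sum>j<n. x $ j * (\<pi> \<bullet> col A j)) + \<tau> * (\<Sum>j<n. x $ j)"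
    by (simp add: algebra_simps sum.distrib sum_subtractf sum_distrib_left)
  also have "(\<Sum>j<n. x $ j * (\<pi> \<bullet> col A j)) = \<pi> \<bullet> (A *\<^sub>v x)"
    using scalar_prod_mult_mat_vec[OF A x(1) \<pi>(1)] by simp
  also have "(\<Sum>j<n. \<nu> $ j) = \<nu> \<bullet> ones_vec n"
    by (simp add: scalar_prod_def ones_vec_def atLeast0LessThan)
  \<comment> \<open>It remains to replace \<open>\<pi> \<bullet> (A *\<^sub>v x)\<close> by the
    larger \<open>\<pi> \<bullet> b\<close>, using \<open>\<pi>\<close> nonnegative, and the sum of
    the entries of \<open>x\<close> by \<open>s\<close>.\<close>
  finally show ?thesis
    using scalar_prod_mono[OF \<pi>(2) x(3) b] sum_x by (simp add: dmix_obj_def)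
qed

theorem theorem2p11:
  fixes n s p m :: nat
    and C A :: "real mat" and b :: "real vec"
    and k :: "nat \<Rightarrow> nat"
    and L :: "nat \<Rightarrow> nat \<Rightarrow> real mat"
    and f :: "nat \<Rightarrow> real mat \<Rightarrow> ereal"
    and \<alpha> :: "real vec"
    and What :: "nat \<Rightarrow> real mat \<Rightarrow> real mat"
    and \<rho> :: "nat \<Rightarrow> real"
    and LB :: ereal
    and \<Theta> :: "nat \<Rightarrow> real mat"
    and \<upsilon> \<nu> \<pi> x0 xopt :: "real vec"
    and \<tau> \<zeta> :: real
  assumes "1 < n" and "0 < s" and "s < n"
    and "C \<in> psd_mats n"
    and "A \<in> carrier_mat p n" and "b \<in> carrier_vec p"
    and "1 \<le> m"
    and k_le: "\<And>i. i < m \<Longrightarrow> k i \<le> n"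
    and L_symm: "\<And>i j. i < m \<Longrightarrow> j \<le> n \<Longrightarrow> L i j \<in> symm_mats (k i)"
    and L_psd: "\<And>i x. i < m \<Longrightarrow> x \<in> carrier_vec n \<Longrightarrow> 0\<^sub>v n \<le> x \<Longrightarrow> x \<le> ones_vec n \<Longrightarrow>
                  affine_mat n (k i) (L i) x \<in> psd_mats (k i)"
    and f_not_PInf: "\<And>i W. i < m \<Longrightarrow> W \<in> psd_mats (k i) \<Longrightarrow> f i W \<noteq> \<infinity>"
    and f_concave: "\<And>i. i < m \<Longrightarrow> concave_ext_on (psd_mats (k i)) (f i)"
    and relaxation: "\<And>i x. i < m \<Longrightarrow> cmesp_feasible n s A b x \<Longrightarrow>
                  cmesp_obj C x \<le> f i (affine_mat n (k i) (L i) x)"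
    and "\<alpha> \<in> carrier_vec m" and "0\<^sub>v m \<le> \<alpha>" and "ones_vec m \<bullet> \<alpha> = 1"
    and What_psd: "\<And>i T. i < m \<Longrightarrow> T \<in> pd_mats (k i) \<Longrightarrow> What i T \<in> psd_mats (k i)"
    and What_sup: "\<And>i T. i < m \<Longrightarrow> T \<in> pd_mats (k i) \<Longrightarrow>
                  f i (What i T) - ereal (mat_inner T (What i T))
                    = (SUP W\<in>psd_mats (k i). f i W - ereal (mat_inner T W))"
    and What_finite: "\<And>i T. i < m \<Longrightarrow> T \<in> pd_mats (k i) \<Longrightarrow> \<bar>f i (What i T)\<bar> \<noteq> \<infinity>"
    and What_rho: "\<And>i T. i < m \<Longrightarrow> T \<in> pd_mats (k i) \<Longrightarrow> mat_inner T (What i T) = \<rho> i"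
    and sup_not_pd: "\<And>i T. i < m \<Longrightarrow> T \<in> symm_mats (k i) \<Longrightarrow> T \<notin> pd_mats (k i) \<Longrightarrow>
                  (SUP W\<in>psd_mats (k i). f i W - ereal (mat_inner T W)) = \<infinity>"
    and "cmesp_feasible n s A b x0" and "LB = cmesp_obj C x0"
    and "dmix_feasible n p m A k L \<alpha> \<Theta> \<upsilon> \<nu> \<pi> \<tau>"
    and "\<zeta> = dmix_obj n s m b L f What \<rho> \<alpha> \<Theta> \<nu> \<pi> \<tau>"
    and "cmesp_optimal n s C A b xopt"
  shows "(\<forall>j<n. ereal \<zeta> - LB < ereal (\<upsilon> $ j) \<longrightarrow> xopt $ j = 0) \<and>
         (\<forall>j<n. ereal \<zeta> - LB < ereal (\<nu> $ j) \<longrightarrow> xopt $ j = 1)"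
proof -
  have feas: "cmesp_feasible n s A b xopt"
    and LB_le: "LB \<le> cmesp_obj C xopt"
    using assms unfolding cmesp_optimal_def by auto
  have \<Theta>: "\<Theta> i \<in> pd_mats (k i)" if "i < m" for i
    using \<open>dmix_feasible n p m A k L \<alpha> \<Theta> \<upsilon> \<nu> \<pi> \<tau>\<close> that unfolding dmix_feasible_def by blast
  have x01: "xopt \<in> carrier_vec n" "0\<^sub>v n \<le> xopt" "xopt \<le> ones_vec n"
    "ones_vec n \<bullet> xopt = real s" "A *\<^sub>v xopt \<le> b"
    using feas unfolding cmesp_feasible_def less_eq_vec_def ones_vec_def by force+
  have "0\<^sub>v n \<le> \<upsilon>" "0\<^sub>v n \<le> \<nu>" "\<upsilon> \<in> carrier_vec n" "\<nu> \<in> carrier_vec n"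
    using \<open>dmix_feasible n p m A k L \<alpha> \<Theta> \<upsilon> \<nu> \<pi> \<tau>\<close> unfolding dmix_feasible_def by blast+
  then have nonneg: "0 \<le> \<upsilon> $ j" "0 \<le> \<nu> $ j" if "j < n" for j
    using that by (simp_all add: less_eq_vec_def)
  have gap: "ereal (\<upsilon> $ j * xopt $ j + \<nu> $ j * (1 - xopt $ j)) \<le> ereal \<zeta> - LB"
    if j: "j < n" for j
  \<comment> \<open>If \<open>LB = -\<infinity>\<close>, the right-hand side is
    \<open>\<infinity>\<close> and the bound is trivial.\<close>
  proof (cases "LB = - \<infinity>")
    case False
    \<comment> \<open>The optimal value lies above \<open>LB\<close>, hence above
      \<open>-\<infinity>\<close>, and \<open>ldet\<close> never takes the value
      \<open>\<infinity>\<close>.\<close>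
    then obtain z where z: "cmesp_obj C xopt = ereal z"
      using LB_le ldet_not_PInf[of "submatrix C (supp_vec xopt) (supp_vec xopt)"]
      unfolding cmesp_obj_def[symmetric] by (cases "cmesp_obj C xopt") auto
    have bound: "z \<le> mix_Omega f What i (\<Theta> i) - \<rho> i
        + mat_inner (\<Theta> i) (affine_mat n (k i) (L i) xopt)" if i: "i < m" for i
      unfolding mix_Omega_def
    proof (rule conjugate_bound)
      let ?X = "affine_mat n (k i) (L i) xopt"
      show "ereal z \<le> f i ?X" using relaxation[OF i feas] z by simp
      \<comment> \<open>Fenchel inequality: \<open>?X\<close> is a competitor in the supremum
        attained at \<open>What i (\<Theta> i)\<close>, where the linear term equals
        \<open>\<rho> i\<close>.\<close>
      show "f i ?X - ereal (mat_inner (\<Theta> i) ?X) \<le> f i (What i (\<Theta> i)) - ereal (\<rho> i)"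
        using What_sup[OF i \<Theta>[OF i]] What_rho[OF i \<Theta>[OF i]]
          SUP_upper[OF L_psd[OF i x01(1-3)], of "\<lambda>W. f i W - ereal (mat_inner (\<Theta> i) W)"]
        by simp
    qed (rule What_finite[OF i \<Theta>[OF i]])
    have "z + (\<Sum>l<n. \<upsilon> $ l * xopt $ l + \<nu> $ l * (1 - xopt $ l)) \<le> \<zeta>"
      unfolding \<open>\<zeta> = _\<close>
      using assms(5,6,14-16) x01 bound L_symm
      by (intro dmix_slack[OF \<open>dmix_feasible n p m A k L \<alpha> \<Theta> \<upsilon> \<nu> \<pi> \<tau>\<close>])
        (auto simp: symm_mats_def)
    \<comment> \<open>All slack terms are nonnegative because \<open>xopt\<close> lies in the unit
      box, so a single one is at most their sum.\<close>
    moreover have "\<upsilon> $ j * xopt $ j + \<nu> $ j * (1 - xopt $ j)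
        \<le> (\<Sum>l<n. \<upsilon> $ l * xopt $ l + \<nu> $ l * (1 - xopt $ l))"
      using j nonneg x01(1-3) unfolding less_eq_vec_def ones_vec_def
      by (intro member_le_sum) auto
    ultimately show ?thesis using LB_le z by (cases LB) auto
  qed simp
  have "xopt $ j = 0 \<or> xopt $ j = 1" if "j < n" for j
    using feas that unfolding cmesp_feasible_def by auto
  \<comment> \<open>The slack term of index \<open>j\<close> is \<open>\<upsilon> $ j\<close> if
    \<open>xopt $ j = 1\<close> and \<open>\<nu> $ j\<close> if \<open>xopt $ j = 0\<close>; a
    strict inequality in the premise therefore rules out that value and leaves the other.\<close>
  with gap show ?thesis by force
qed

end
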